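(* Let $B$ be a finite subset of $\mathrm{N}$. Then $\mathrm{SAT}(\{\mathsf{F},\mathsf{G},\mathsf{X},\mathsf{U},\mathsf{S}\},B)$ can be decided in polynomial time.
   Context: A Boolean function is a map $f:\{0,1\}^n\to\{0,1\}$; each is used as an $n$-ary propositional connective. $\mathrm{N}$ is the set of Boolean functions that depend on at most one variable (it is generated by negation and the constants $0,1$). A temporal $B$-formula over a set $M$ of temporal operators is built from propositional variables using connectives from $B$ and operators from $M$. A structure $S=(s,V,\xi)$ is an infinite sequence $(s_i)_{i\in\mathbb N}$ of distinct states, a variable set $V$, and $\xi$ assigning to each state the set of variables true there. Semantics: $S,s_i\models x$ iff $x\in\xi(s_i)$; Boolean connectives pointwise; $S,s_i\models\mathsf{X}\varphi$ iff $S,s_{i+1}\models\varphi$; $S,s_i\models\varphi_1\mathsf{U}\varphi_2$ iff some $k\ge i$ has $S,s_k\models\varphi_2$ and $S,s_j\models\varphi_1$ for all $i\le j<k$; $S,s_i\models\varphi_1\mathsf{S}\varphi_2$ iff some $k\le i$ has $S,s_k\models\varphi_2$ and $S,s_j\models\varphi_1$ for all $k<j\le i$; $\mathsf{F}\varphi=\mathrm{true}\,\mathsf{U}\,\varphi$, $\mathsf{G}\varphi=\neg\mathsf{F}\neg\varphi$. A formula is satisfiable if it holds at some state of some structure. $\mathrm{SAT}(M,B)$ is the problem of deciding satisfiability of temporal $B$-formulae over $M$. *)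

theory Defs
  imports "HOL-Library.FuncSet" "HOL-Computational_Algebra.Polynomial"
begin

section \<open>Boolean functions\<close>

text \<open>A pair \<open>(n, f)\<close> stands for the function \<open>f\<close> from \<open>{0,1}\<^sup>n\<close> to \<open>{0,1}\<close>. Requiring \<open>f\<close> to be
  extensional makes equality of pairs coincide with equality of Boolean functions, so that finite
  sets of pairs are the same thing as finite sets of Boolean functions.\<close>

type_synonym boolfun = "nat \<times> (bool list \<Rightarrow> bool)"

definition boolean_functions :: "boolfun set" where
  "boolean_functions = {(n, f). f \<in> extensional {xs. length xs = n}}"

definition depends_on :: "boolfun \<Rightarrow> nat \<Rightarrow> bool" where
  "depends_on c i \<longleftrightarrow> i < fst c \<and>
     (\<exists>xs. length xs = fst c \<and> snd c (xs[i := True]) \<noteq> snd c (xs[i := False]))"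

definition clone_N :: "boolfun set" where
  "clone_N = {c \<in> boolean_functions. card {i. depends_on c i} \<le> 1}"

section \<open>Temporal formulae\<close>

datatype temporal_op = OpF | OpG | OpX | OpU | OpS

datatype 'v formula =
    Var 'v
  | Conn boolfun "'v formula list"
  | Finally "'v formula"
  | Globally "'v formula"
  | Next "'v formula"
  | Until "'v formula" "'v formula"
  | Since "'v formula" "'v formula"

fun temporal_formula :: "temporal_op set \<Rightarrow> boolfun set \<Rightarrow> 'v formula \<Rightarrow> bool" where
  "temporal_formula M B (Var x) \<longleftrightarrow> True"
| "temporal_formula M B (Conn c \<phi>s) \<longleftrightarrow>
     c \<in> B \<and> length \<phi>s = fst c \<and> (\<forall>\<phi>\<in>set \<phi>s. temporal_formula M B \<phi>)"
| "temporal_formula M B (Finally \<phi>) \<longleftrightarrow> OpF \<in> M \<and> temporal_formula M B \<phi>"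
| "temporal_formula M B (Globally \<phi>) \<longleftrightarrow> OpG \<in> M \<and> temporal_formula M B \<phi>"
| "temporal_formula M B (Next \<phi>) \<longleftrightarrow> OpX \<in> M \<and> temporal_formula M B \<phi>"
| "temporal_formula M B (Until \<phi> \<psi>) \<longleftrightarrow>
     OpU \<in> M \<and> temporal_formula M B \<phi> \<and> temporal_formula M B \<psi>"
| "temporal_formula M B (Since \<phi> \<psi>) \<longleftrightarrow>
     OpS \<in> M \<and> temporal_formula M B \<phi> \<and> temporal_formula M B \<psi>"

record ('s, 'v) temporal_structure =
  states :: "nat \<Rightarrow> 's"
  variables :: "'v set"
  labelling :: "'s \<Rightarrow> 'v set"

definition is_structure :: "('s, 'v) temporal_structure \<Rightarrow> bool" where
  "is_structure S \<longleftrightarrow> inj (states S) \<and> (\<forall>i. labelling S (states S i) \<subseteq> variables S)"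

text \<open>\<open>holds S i \<phi>\<close> is satisfaction of \<open>\<phi>\<close> at the \<open>i\<close>-th state of \<open>S\<close>; the clauses for
  \<open>Finally\<close> and \<open>Globally\<close> unfold \<open>true U \<phi>\<close> and \<open>\<not> F \<not> \<phi>\<close>.\<close>

fun holds :: "('s, 'v) temporal_structure \<Rightarrow> nat \<Rightarrow> 'v formula \<Rightarrow> bool" where
  "holds S i (Var x) \<longleftrightarrow> x \<in> labelling S (states S i)"
| "holds S i (Conn c \<phi>s) \<longleftrightarrow> snd c (map (\<lambda>\<phi>. holds S i \<phi>) \<phi>s)"
| "holds S i (Finally \<phi>) \<longleftrightarrow> (\<exists>k\<ge>i. holds S k \<phi>)"
| "holds S i (Globally \<phi>) \<longleftrightarrow> \<not> (\<exists>k\<ge>i. \<not> holds S k \<phi>)"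
| "holds S i (Next \<phi>) \<longleftrightarrow> holds S (i + 1) \<phi>"
| "holds S i (Until \<phi> \<psi>) \<longleftrightarrow>
     (\<exists>k\<ge>i. holds S k \<psi> \<and> (\<forall>j. i \<le> j \<and> j < k \<longrightarrow> holds S j \<phi>))"
| "holds S i (Since \<phi> \<psi>) \<longleftrightarrow>
     (\<exists>k\<le>i. holds S k \<psi> \<and> (\<forall>j. k < j \<and> j \<le> i \<longrightarrow> holds S j \<phi>))"

text \<open>As only the sequence of labels matters, it is no restriction to take the states from a fixed
  infinite type.\<close>

definition satisfiable :: "'v formula \<Rightarrow> bool" where
  "satisfiable \<phi> \<longleftrightarrow> (\<exists>(S :: (nat, 'v) temporal_structure) i. is_structure S \<and> holds S i \<phi>)"

section \<open>Deterministic multi-tape Turing machines\<close>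

text \<open>Tapes are infinite in both directions. For an input alphabet of type \<open>'a\<close>, tape symbols
  are \<open>Inl a\<close> for input symbols \<open>a\<close>, and \<open>Inr n\<close> for further work symbols; \<open>Inr 0\<close> is the blank.\<close>

datatype move = MoveLeft | Stay | MoveRight

type_synonym 'a tape_symbol = "'a + nat"

abbreviation blank :: "'a tape_symbol" where
  "blank \<equiv> Inr 0"

record 'a turing_machine =
  tape_count :: nat
  control_states :: "nat set"
  tape_alphabet :: "'a tape_symbol set"
  start_state :: nat
  accept_state :: nat
  reject_state :: nat
  transition :: "nat \<Rightarrow> 'a tape_symbol list \<Rightarrow> nat \<times> 'a tape_symbol list \<times> move list"

definition is_turing_machine :: "'a set \<Rightarrow> 'a turing_machine \<Rightarrow> bool" where
  "is_turing_machine \<Sigma> M \<longleftrightarrow>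
     tape_count M \<ge> 1 \<and>
     finite (control_states M) \<and>
     finite (tape_alphabet M) \<and> Inl ` \<Sigma> \<subseteq> tape_alphabet M \<and> blank \<in> tape_alphabet M \<and>
     start_state M \<in> control_states M \<and>
     accept_state M \<in> control_states M \<and>
     reject_state M \<in> control_states M \<and>
     accept_state M \<noteq> reject_state M \<and>
     (\<forall>q \<in> control_states M - {accept_state M, reject_state M}.
        \<forall>gs \<in> lists (tape_alphabet M). length gs = tape_count M \<longrightarrow>
          (case transition M q gs of (q', hs, ms) \<Rightarrow>
             q' \<in> control_states M \<and>
             hs \<in> lists (tape_alphabet M) \<and> length hs = tape_count M \<and>
             length ms = tape_count M))"

text \<open>A tape is given by its contents and the position of its head.\<close>

type_synonym 'a tape = "(int \<Rightarrow> 'a tape_symbol) \<times> int"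
type_synonym 'a configuration = "nat \<times> 'a tape list"

fun read_tape :: "'a tape \<Rightarrow> 'a tape_symbol" where
  "read_tape (t, p) = t p"

fun move_head :: "move \<Rightarrow> int \<Rightarrow> int" where
  "move_head MoveLeft p = p - 1"
| "move_head Stay p = p"
| "move_head MoveRight p = p + 1"

fun update_tape :: "'a tape \<Rightarrow> 'a tape_symbol \<Rightarrow> move \<Rightarrow> 'a tape" where
  "update_tape (t, p) h m = (t(p := h), move_head m p)"

fun step :: "'a turing_machine \<Rightarrow> 'a configuration \<Rightarrow> 'a configuration" where
  "step M (q, ts) =
     (if q = accept_state M \<or> q = reject_state M then (q, ts)
      else case transition M q (map read_tape ts) of (q', hs, ms) \<Rightarrow>
        (q', map (\<lambda>(t, h, m). update_tape t h m) (zip ts (zip hs ms))))"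

definition input_tape :: "'a list \<Rightarrow> 'a tape" where
  "input_tape w = (\<lambda>p. if 0 \<le> p \<and> p < int (length w) then Inl (w ! nat p) else blank, 0)"

definition blank_tape :: "'a tape" where
  "blank_tape = (\<lambda>p. blank, 0)"

definition initial_configuration :: "'a turing_machine \<Rightarrow> 'a list \<Rightarrow> 'a configuration" where
  "initial_configuration M w =
     (start_state M, input_tape w # replicate (tape_count M - 1) blank_tape)"

definition decides_in_time ::
  "'a turing_machine \<Rightarrow> 'a set \<Rightarrow> 'a list set \<Rightarrow> (nat \<Rightarrow> nat) \<Rightarrow> bool" where
  "decides_in_time M \<Sigma> L T \<longleftrightarrow>
     (\<forall>w \<in> lists \<Sigma>. \<exists>t \<le> T (length w).
        fst ((step M ^^ t) (initial_configuration M w)) =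
          (if w \<in> L then accept_state M else reject_state M))"

definition polynomial_time_decidable :: "'a set \<Rightarrow> 'a list set \<Rightarrow> bool" where
  "polynomial_time_decidable \<Sigma> L \<longleftrightarrow>
     finite \<Sigma> \<and> L \<subseteq> lists \<Sigma> \<and>
     (\<exists>M (p :: nat poly). is_turing_machine \<Sigma> M \<and> decides_in_time M \<Sigma> L (poly p))"

section \<open>The satisfiability problem\<close>

text \<open>Formulae are presented to machines in Polish notation. The propositional variables are named
  by words over \<open>{0,1}\<close>, and a variable is written as a marker followed by its name; each
  connective and each temporal operator is a single letter. The lemma \<open>encode_unique\<close>
  below shows that this is uniquely readable.\<close>

datatype letter = LVar | LBit bool | LConn boolfun | LTemp temporal_op

fun encode :: "bool list formula \<Rightarrow> letter list" where
  "encode (Var x) = LVar # map LBit x"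
| "encode (Conn c \<phi>s) = LConn c # concat (map encode \<phi>s)"
| "encode (Finally \<phi>) = LTemp OpF # encode \<phi>"
| "encode (Globally \<phi>) = LTemp OpG # encode \<phi>"
| "encode (Next \<phi>) = LTemp OpX # encode \<phi>"
| "encode (Until \<phi> \<psi>) = LTemp OpU # encode \<phi> @ encode \<psi>"
| "encode (Since \<phi> \<psi>) = LTemp OpS # encode \<phi> @ encode \<psi>"

definition alphabet :: "temporal_op set \<Rightarrow> boolfun set \<Rightarrow> letter set" where
  "alphabet M B = {LVar, LBit False, LBit True} \<union> LConn ` B \<union> LTemp ` M"

definition SAT :: "temporal_op set \<Rightarrow> boolfun set \<Rightarrow> letter list set" where
  "SAT M B = {encode \<phi> | \<phi>. temporal_formula M B \<phi> \<and> satisfiable \<phi>}"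

fun no_bit_first :: "letter list \<Rightarrow> bool" where
  "no_bit_first (LBit b # u) \<longleftrightarrow> False"
| "no_bit_first u \<longleftrightarrow> True"

lemma no_bit_first_encode: "no_bit_first (encode \<phi> @ u)"
  by (cases \<phi>) auto

lemma no_bit_first_concat: "no_bit_first u \<Longrightarrow> no_bit_first (concat (map encode \<phi>s) @ u)"
  by (cases \<phi>s) (auto simp: no_bit_first_encode)

lemma bits_unique:
  "map LBit x @ u = map LBit y @ v \<Longrightarrow> no_bit_first u \<Longrightarrow> no_bit_first v \<Longrightarrow> x = y \<and> u = v"
proof (induction x arbitrary: y)
  case Nil
  then show ?case by (cases y) auto
next
  case (Cons a x)
  then show ?case by (cases y) auto
qed

lemma encode_unique_prefix:
  assumes "temporal_formula M B \<phi>" "temporal_formula M B \<psi>"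
    and "encode \<phi> @ u = encode \<psi> @ v" "no_bit_first u" "no_bit_first v"
  shows "\<phi> = \<psi> \<and> u = v"
  using assms
proof (induction \<phi> arbitrary: \<psi> u v)
  case (Var x)
  then show ?case by (cases \<psi>) (auto dest: bits_unique)
next
  case (Conn c \<phi>s)
  from Conn.prems obtain \<psi>s where \<psi>: "\<psi> = Conn c \<psi>s" by (cases \<psi>) auto
  have "\<phi>s = \<psi>s \<and> u = v"
    if "length \<phi>s = length \<psi>s" "\<forall>\<phi>\<in>set \<phi>s. temporal_formula M B \<phi>"
      "\<forall>\<phi>\<in>set \<psi>s. temporal_formula M B \<phi>"
      "concat (map encode \<phi>s) @ u = concat (map encode \<psi>s) @ v"
    using that(1-4) Conn.IH
  proof (induction \<phi>s \<psi>s rule: list_induct2)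
    case Nil
    then show ?case by simp
  next
    case (Cons x xs y ys)
    have "x = y \<and> concat (map encode xs) @ u = concat (map encode ys) @ v"
      by (rule Cons.prems(4)[of x])
        (use Cons.prems(1-3) Conn.prems(4,5) in \<open>auto intro: no_bit_first_concat\<close>)
    moreover from this have "xs = ys \<and> u = v"
      by (intro Cons.IH) (use Cons.prems(1-3) in simp_all, metis Cons.prems(4) list.set_intros(2))
    ultimately show ?case by simp
  qed
  then have "\<phi>s = \<psi>s \<and> u = v"
    using Conn.prems(1-3) unfolding \<psi> by simp
  with \<psi> show ?case by simp
next
  case (Finally \<phi>)
  from Finally.prems obtain \<psi>1 where \<psi>: "\<psi> = Finally \<psi>1" by (cases \<psi>) auto
  have "\<phi> = \<psi>1 \<and> u = v"
    by (rule Finally.IH) (use Finally.prems \<psi> in auto)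
  with \<psi> show ?case by simp
next
  case (Globally \<phi>)
  from Globally.prems obtain \<psi>1 where \<psi>: "\<psi> = Globally \<psi>1" by (cases \<psi>) auto
  have "\<phi> = \<psi>1 \<and> u = v"
    by (rule Globally.IH) (use Globally.prems \<psi> in auto)
  with \<psi> show ?case by simp
next
  case (Next \<phi>)
  from Next.prems obtain \<psi>1 where \<psi>: "\<psi> = Next \<psi>1" by (cases \<psi>) auto
  have "\<phi> = \<psi>1 \<and> u = v"
    by (rule Next.IH) (use Next.prems \<psi> in auto)
  with \<psi> show ?case by simp
next
  case (Until \<phi>1 \<phi>2)
  from Until.prems obtain \<psi>1 \<psi>2 where \<psi>: "\<psi> = Until \<psi>1 \<psi>2" by (cases \<psi>) auto
  have "\<phi>1 = \<psi>1 \<and> encode \<phi>2 @ u = encode \<psi>2 @ v"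
    by (rule Until.IH(1)) (use Until.prems \<psi> in \<open>auto simp: no_bit_first_encode\<close>)
  moreover from this have "\<phi>2 = \<psi>2 \<and> u = v"
    by (intro Until.IH(2)) (use Until.prems \<psi> in auto)
  ultimately show ?case using \<psi> by simp
next
  case (Since \<phi>1 \<phi>2)
  from Since.prems obtain \<psi>1 \<psi>2 where \<psi>: "\<psi> = Since \<psi>1 \<psi>2" by (cases \<psi>) auto
  have "\<phi>1 = \<psi>1 \<and> encode \<phi>2 @ u = encode \<psi>2 @ v"
    by (rule Since.IH(1)) (use Since.prems \<psi> in \<open>auto simp: no_bit_first_encode\<close>)
  moreover from this have "\<phi>2 = \<psi>2 \<and> u = v"
    by (intro Since.IH(2)) (use Since.prems \<psi> in auto)
  ultimately show ?case using \<psi> by simp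
qed

lemma encode_unique:
  assumes "temporal_formula M B \<phi>" "temporal_formula M B \<psi>" "encode \<phi> = encode \<psi>"
  shows "\<phi> = \<psi>"
  using encode_unique_prefix[OF assms(1,2), of "[]" "[]"] assms(3) by simp

end

theory Submission
  imports Defs "HOL-Library.Countable"
begin

text \<open>In a structure whose label is the same at every state, each temporal operator returns the
  value of its last argument. Connectives from \<open>clone_N\<close> look at only one argument,
  so a formula that has the same value in the two structures where everything is true, respectively
  everything is false, has this value at every state of every structure. Hence satisfiability only
  depends on the pair of truth values in these two structures. Reading the Polish notation
  backwards, a machine with a stack computes this pair, and checks well-formedness, in linear
  time.\<close>

section \<open>Constant structures\<close>

text \<open>In a constant structure the witness for \<open>Until\<close> and \<open>Since\<close>
  can always be the current state. The range left to the first argument is then empty, so the second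
  argument alone gives the value.\<close>

fun const_val :: "bool \<Rightarrow> 'v formula \<Rightarrow> bool" where
  "const_val b (Var x) = b"
| "const_val b (Conn c \<phi>s) = snd c (map (\<lambda>\<phi>. const_val b \<phi>) \<phi>s)"
| "const_val b (Finally \<phi>) = const_val b \<phi>"
| "const_val b (Globally \<phi>) = const_val b \<phi>"
| "const_val b (Next \<phi>) = const_val b \<phi>"
| "const_val b (Until \<phi> \<psi>) = const_val b \<psi>"
| "const_val b (Since \<phi> \<psi>) = const_val b \<psi>"

lemma holds_const_structure:
  assumes "\<And>i. labelling S (states S i) = (if b then UNIV else {})"
  shows "holds S i \<phi> = const_val b \<phi>"
proof (induction \<phi> arbitrary: i)
  case (Conn c \<phi>s)
  then have "map (holds S i) \<phi>s = map (const_val b) \<phi>s" by simp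
  then show ?case by (simp only: holds.simps const_val.simps)
qed (auto simp: assms)

section \<open>Boolean functions with at most one relevant argument\<close>

text \<open>\<open>xs\<close> is turned into \<open>ys\<close> one coordinate at a time. Each change
  either touches an irrelevant position or replaces an entry by an equal one.\<close>

lemma boolfun_cong_depends_on:
  assumes "length xs = fst c" "length ys = fst c"
    and "\<And>i. depends_on c i \<Longrightarrow> xs ! i = ys ! i"
  shows "snd c xs = snd c ys"
proof -
  have "snd c (take k ys @ drop k xs) = snd c xs" if "k \<le> fst c" for k
    using that
  proof (induction k)
    case (Suc k)
    define zs where "zs = take k ys @ drop k xs"
    have len: "length zs = fst c" using Suc.prems assms by (simp add: zs_def)
    \<comment> \<open>Two consecutive hybrids become updates of the same list at \<open>k\<close>,
      which is the form in which \<open>depends_on\<close> compares values.\<close>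
    have old: "zs = zs[k := xs ! k]"
      using Suc.prems assms(1,2) by (auto simp: zs_def list_eq_iff_nth_eq nth_append nth_list_update)
    have new: "take (Suc k) ys @ drop (Suc k) xs = zs[k := ys ! k]"
      using Suc.prems assms(1,2)
      by (auto simp: zs_def list_eq_iff_nth_eq nth_append nth_list_update less_Suc_eq)
    have "snd c (zs[k := ys ! k]) = snd c (zs[k := xs ! k])"
    proof (cases "depends_on c k")
      case True
      then show ?thesis using assms(3) by simp
    next
      case False
      then have "snd c (zs[k := True]) = snd c (zs[k := False])"
        using Suc.prems len by (auto simp: depends_on_def)
      then show ?thesis by (cases "xs ! k"; cases "ys ! k") simp_all
    qed
    with Suc old new show ?case by (simp add: zs_def)
  qed simp
  from this[of "fst c"] show ?thesis using assms by simp
qed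

text \<open>Agreement at \<open>i\<close> is only asked for when \<open>i < fst c\<close>: a
  constant function has no relevant position, and its \<open>i\<close> may lie beyond the
  arity.\<close>

lemma clone_N_single_argument:
  assumes "c \<in> clone_N"
  obtains i where "\<And>xs ys. length xs = fst c \<Longrightarrow> length ys = fst c \<Longrightarrow>
    (i < fst c \<Longrightarrow> xs ! i = ys ! i) \<Longrightarrow> snd c xs = snd c ys"
proof -
  \<comment> \<open>Finiteness matters because an infinite set would also have \<open>card\<close>
    equal to 0.\<close>
  have "finite {i. depends_on c i}"
    by (rule finite_subset[of _ "{..<fst c}"]) (auto simp: depends_on_def)
  then have "\<forall>i j. depends_on c i \<longrightarrow> depends_on c j \<longrightarrow> i = j"
    using assms by (auto simp: clone_N_def card_le_Suc0_iff_eq)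
  then have "\<exists>i. {i. depends_on c i} \<subseteq> {i}" by blast
  then obtain i where i: "{i. depends_on c i} \<subseteq> {i}" ..
  show thesis
  proof (rule that[of i])
    fix xs ys :: "bool list"
    assume "length xs = fst c" "length ys = fst c" "i < fst c \<Longrightarrow> xs ! i = ys ! i"
    then show "snd c xs = snd c ys"
      using i by (intro boolfun_cong_depends_on) (auto simp: depends_on_def)
  qed
qed

text \<open>At a connective only the relevant argument counts. If its two constant values agree, the
  induction hypothesis fixes its value at every state. If they differ, its value at the given state
  is one of them, and the connective takes the same value on both.\<close>

lemma holds_eq_const_val:
  assumes "B \<subseteq> clone_N" "temporal_formula M B \<phi>" "const_val True \<phi> = const_val False \<phi>"
  shows "holds S i \<phi> = const_val True \<phi>"
  using assms(2,3)
proof (induction \<phi> arbitrary: i)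
  case (Conn c \<phi>s)
  let ?h = "map (holds S i) \<phi>s" and ?v = "\<lambda>b. map (const_val b) \<phi>s"
  have c: "c \<in> clone_N" and len: "length \<phi>s = fst c" using Conn.prems assms(1) by auto
  from c obtain j where j: "\<And>xs ys. length xs = fst c \<Longrightarrow> length ys = fst c \<Longrightarrow>
      (j < fst c \<Longrightarrow> xs ! j = ys ! j) \<Longrightarrow> snd c xs = snd c ys"
    by (rule clone_N_single_argument) blast
  \<comment> \<open>The choice of \<open>b\<close> may depend on the state \<open>i\<close>; this is
    harmless because the connective has the same value for both \<open>b\<close>.\<close>
  have "\<exists>b. j < fst c \<longrightarrow> ?h ! j = ?v b ! j"
  proof (cases "j < fst c \<and> const_val True (\<phi>s ! j) = const_val False (\<phi>s ! j)")
    case True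
    then have "holds S i (\<phi>s ! j) = const_val True (\<phi>s ! j)"
      using Conn.prems len by (intro Conn.IH) auto
    then show ?thesis using len by auto
  next
    case False
    then show ?thesis using len by auto
  qed
  then obtain b where "j < fst c \<longrightarrow> ?h ! j = ?v b ! j" ..
  then have "snd c ?h = snd c (?v b)" using len by (intro j) simp_all
  then show ?case using Conn.prems(2) by (cases b) simp_all
qed auto

definition const_vals :: "'v formula \<Rightarrow> bool \<times> bool" where
  "const_vals \<phi> = (const_val True \<phi>, const_val False \<phi>)"

text \<open>If both values are false they agree, so the formula is false everywhere. A true value is
  realised by the corresponding constant structure.\<close>

lemma satisfiable_iff_const_vals:
  assumes "B \<subseteq> clone_N" "temporal_formula M B \<phi>"
  shows "satisfiable \<phi> \<longleftrightarrow> fst (const_vals \<phi>) \<or> snd (const_vals \<phi>)"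
proof
  assume "satisfiable \<phi>"
  then show "fst (const_vals \<phi>) \<or> snd (const_vals \<phi>)"
    using holds_eq_const_val[OF assms] by (auto simp: satisfiable_def const_vals_def)
next
  assume "fst (const_vals \<phi>) \<or> snd (const_vals \<phi>)"
  then obtain b where b: "const_val b \<phi>" by (auto simp: const_vals_def)
  define S :: "(nat, 'a) temporal_structure" where
    "S = \<lparr>states = id, variables = UNIV, labelling = \<lambda>_. if b then UNIV else {}\<rparr>"
  have "holds S 0 \<phi>" using b by (subst holds_const_structure[of _ b]) (simp_all add: S_def)
  moreover have "is_structure S" by (simp add: S_def is_structure_def)
  ultimately show "satisfiable \<phi>" unfolding satisfiable_def by blast
qed

section \<open>Evaluating Polish notation backwards\<close>

fun is_bit :: "letter \<Rightarrow> bool" where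
  "is_bit (LBit b) = True"
| "is_bit _ = False"

fun arity :: "letter \<Rightarrow> nat" where
  "arity LVar = 0"
| "arity (LBit b) = 0"
| "arity (LConn c) = fst c"
| "arity (LTemp m) = (if m = OpU \<or> m = OpS then 2 else 1)"

text \<open>Reading from right to left leaves the first argument on top of the stack, so
  \<open>vs\<close> lists the arguments in their original order. \<open>(True, False)\<close> is
  \<open>const_vals\<close> of a variable.\<close>

fun apply_letter :: "letter \<Rightarrow> (bool \<times> bool) list \<Rightarrow> bool \<times> bool" where
  "apply_letter (LConn c) vs = (snd c (map fst vs), snd c (map snd vs))"
| "apply_letter (LTemp m) vs = last vs"
| "apply_letter _ vs = (True, False)"

text \<open>The Boolean component of the result tells whether the word starts with bits still waiting
  for their variable marker.\<close>

fun eval_word :: "letter list \<Rightarrow> (bool \<times> (bool \<times> bool) list) option" where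
  "eval_word [] = Some (False, [])"
| "eval_word (a # w) = (case eval_word w of
      None \<Rightarrow> None
    | Some (p, st) \<Rightarrow>
        if is_bit a then Some (True, st)
        else if (p \<and> a \<noteq> LVar) \<or> length st < arity a then None
        else Some (False, apply_letter a (take (arity a) st) # drop (arity a) st))"

text \<open>The flag is left open since it depends on whether \<open>x\<close> is empty; a marker
  \<open>LVar\<close> in front accepts either value.\<close>

lemma eval_word_bits:
  "eval_word u = Some (p, st) \<Longrightarrow> \<exists>p'. eval_word (map LBit x @ u) = Some (p', st)"
  by (induction x) auto

text \<open>The arbitrary continuation \<open>u\<close> lets the arguments of an operator be
  evaluated from right to left. Pending bits at its start would be taken into a variable name or
  make another letter fail.\<close>

lemma eval_word_encode:
  assumes "temporal_formula M B \<phi>" "eval_word u = Some (False, st)"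
  shows "eval_word (encode \<phi> @ u) = Some (False, const_vals \<phi> # st)"
  using assms
proof (induction \<phi> arbitrary: u st)
  case (Var x)
  then show ?case using eval_word_bits[of u False st x] by (auto simp: const_vals_def)
next
  case (Conn c \<phi>s)
  \<comment> \<open>Phrased for lists with members in \<open>\<phi>s\<close>, so that the hypothesis
    on the arguments stays available in the list induction.\<close>
  have "eval_word (concat (map encode \<psi>s) @ u) = Some (False, map const_vals \<psi>s @ st)"
    if "set \<psi>s \<subseteq> set \<phi>s" for \<psi>s
    using that
  proof (induction \<psi>s)
    case Nil
    then show ?case using Conn.prems by simp
  next
    case (Cons \<psi> \<psi>s)
    then show ?case
      using Conn.IH[of \<psi> "concat (map encode \<psi>s) @ u" "map const_vals \<psi>s @ st"] Conn.prems by auto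
  qed
  from this[of \<phi>s]
  have "eval_word (concat (map encode \<phi>s) @ u) = Some (False, map const_vals \<phi>s @ st)" by simp
  then show ?case
    using Conn.prems by (simp add: const_vals_def comp_def)
next
  case (Until \<phi> \<psi>)
  then have "eval_word (encode \<phi> @ encode \<psi> @ u) =
      Some (False, const_vals \<phi> # const_vals \<psi> # st)" by simp
  then show ?case by (simp add: const_vals_def)
next
  case (Since \<phi> \<psi>)
  then have "eval_word (encode \<phi> @ encode \<psi> @ u) =
      Some (False, const_vals \<phi> # const_vals \<psi> # st)" by simp
  then show ?case by (simp add: const_vals_def)
qed (simp_all add: const_vals_def)

text \<open>Converse to \<open>eval_word_encode\<close>: success of the evaluation means that the
  word splits into pending bits and one encoded formula per stack entry. This makes the evaluation a
  check of well-formedness.\<close>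

lemma eval_word_decode:
  assumes "w \<in> lists (alphabet {OpF, OpG, OpX, OpU, OpS} B)" "eval_word w = Some (p, st)"
  shows "\<exists>x \<phi>s. w = map LBit x @ concat (map encode \<phi>s) \<and> (p \<longleftrightarrow> x \<noteq> []) \<and>
    st = map const_vals \<phi>s \<and> (\<forall>\<phi>\<in>set \<phi>s. temporal_formula {OpF, OpG, OpX, OpU, OpS} B \<phi>)"
  using assms
proof (induction w arbitrary: p st rule: list.induct)
  case Nil
  then show ?case by (auto intro!: exI[of _ "[]"])
next
  case (Cons a w p st)
  let ?tf = "temporal_formula {OpF, OpG, OpX, OpU, OpS} B :: bool list formula \<Rightarrow> bool"
  obtain p' st' where ev: "eval_word w = Some (p', st')"
    using Cons.prems(2) by (auto split: option.splits)
  then obtain x \<phi>s where w: "w = map LBit x @ concat (map encode \<phi>s)" "p' \<longleftrightarrow> x \<noteq> []"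
      "st' = map const_vals \<phi>s" "\<forall>\<phi>\<in>set \<phi>s. ?tf \<phi>"
    using Cons.IH[OF _ ev] Cons.prems(1) by auto
  have tf: "?tf \<phi>" if "\<phi> \<in> set (take n \<phi>s)" for \<phi> n
    using w(4) that by (meson in_set_takeD)
  \<comment> \<open>Common to all letters other than bits: \<open>a\<close>, the pending bits and
    the first \<open>arity a\<close> formulae combine into one new formula.\<close>
  have result: ?case
    if "encode \<phi> = a # map LBit x @ concat (map encode (take (arity a) \<phi>s))" "?tf \<phi>"
      "\<not> p" "st = const_vals \<phi> # map const_vals (drop (arity a) \<phi>s)" for \<phi>
  proof (intro exI[of _ "[] :: bool list"] exI[of _ "\<phi> # drop (arity a) \<phi>s"] conjI)
    show "\<forall>\<phi>'\<in>set (\<phi> # drop (arity a) \<phi>s). ?tf \<phi>'"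
      using that(2) w(4) by (auto dest: in_set_dropD)
    have "concat (map encode \<phi>s) =
        concat (map encode (take (arity a) \<phi>s)) @ concat (map encode (drop (arity a) \<phi>s))"
      by (metis append_take_drop_id concat_append map_append)
    with that w(1) show "a # w = map LBit [] @ concat (map encode (\<phi> # drop (arity a) \<phi>s))"
      by simp
  qed (use that in simp_all)
  show ?case
  proof (cases a)
    case LVar
    with Cons.prems(2) ev w(3) show ?thesis
      by (intro result[of "Var x"]) (auto simp: const_vals_def)
  next
    case (LBit b)
    with Cons.prems(2) ev w show ?thesis
      by (intro exI[of _ "b # x"] exI[of _ \<phi>s]) auto
  next
    case (LConn c)
    with Cons.prems ev w tf show ?thesis
      by (intro result[of "Conn c (take (fst c) \<phi>s)"])
        (auto simp: const_vals_def take_map drop_map comp_def alphabet_def split: if_splits)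
  next
    case (LTemp m)
    have ok: "length \<phi>s \<ge> arity a" "x = []" "\<not> p"
        "st = last (map const_vals (take (arity a) \<phi>s)) # map const_vals (drop (arity a) \<phi>s)"
      using Cons.prems(2) ev w LTemp by (auto simp: take_map drop_map Suc_le_eq split: if_splits)
    show ?thesis
    proof (cases "m = OpU \<or> m = OpS")
      case True
      with ok(1) LTemp obtain \<phi> \<psi> \<chi>s where \<phi>s: "\<phi>s = \<phi> # \<psi> # \<chi>s"
        by (cases \<phi>s; cases "tl \<phi>s") auto
      show ?thesis
        by (rule result[of "if m = OpU then Until \<phi> \<psi> else Since \<phi> \<psi>"])
          (use True LTemp ok \<phi>s w(4) in \<open>auto simp: const_vals_def numeral_2_eq_2\<close>)
    next
      case False
      with ok(1) LTemp obtain \<phi> \<chi>s where \<phi>s: "\<phi>s = \<phi> # \<chi>s" by (cases \<phi>s) auto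
      show ?thesis
        \<comment> \<open>With \<open>OpU\<close> and \<open>OpS\<close> excluded, the default
          branch is reached only for \<open>OpX\<close>.\<close>
        by (rule result[of "case m of OpF \<Rightarrow> Finally \<phi> | OpG \<Rightarrow> Globally \<phi> | _ \<Rightarrow> Next \<phi>"])
          (use False LTemp ok \<phi>s w(4) in \<open>auto simp: const_vals_def split: temporal_op.split\<close>)
    qed
  qed
qed

definition accepts_word :: "letter list \<Rightarrow> bool" where
  "accepts_word w \<longleftrightarrow> (\<exists>v. eval_word w = Some (False, [v]) \<and> (fst v \<or> snd v))"

lemma SAT_iff_accepts_word:
  assumes "B \<subseteq> clone_N" "w \<in> lists (alphabet {OpF, OpG, OpX, OpU, OpS} B)"
  shows "w \<in> SAT {OpF, OpG, OpX, OpU, OpS} B \<longleftrightarrow> accepts_word w"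
proof
  assume "w \<in> SAT {OpF, OpG, OpX, OpU, OpS} B"
  then obtain \<phi> where \<phi>: "w = encode \<phi>" "temporal_formula {OpF, OpG, OpX, OpU, OpS} B \<phi>"
      "satisfiable \<phi>"
    by (auto simp: SAT_def)
  then have "eval_word w = Some (False, [const_vals \<phi>])"
    using eval_word_encode[of _ B \<phi> "[]"] by auto
  then show "accepts_word w"
    using satisfiable_iff_const_vals[OF assms(1) \<phi>(2)] \<phi>(3) by (auto simp: accepts_word_def)
next
  assume "accepts_word w"
  then obtain v where v: "eval_word w = Some (False, [v])" "fst v \<or> snd v"
    by (auto simp: accepts_word_def)
  obtain \<phi> where "w = encode \<phi>" "v = const_vals \<phi>"
      "temporal_formula {OpF, OpG, OpX, OpU, OpS} B \<phi>"
    using eval_word_decode[OF assms(2) v(1)] by auto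
  with v(2) satisfiable_iff_const_vals[OF assms(1)] show "w \<in> SAT {OpF, OpG, OpX, OpU, OpS} B"
    unfolding SAT_def by blast
qed

lemma encode_in_lists_alphabet:
  "temporal_formula M B \<phi> \<Longrightarrow> encode \<phi> \<in> lists (alphabet M B)"
proof (induction \<phi>)
  case (Var x)
  have "LBit b \<in> alphabet M B" for b by (cases b) (simp_all add: alphabet_def)
  then show ?case by (auto simp: alphabet_def)
next
  case (Conn c \<phi>s)
  then have "LConn c \<in> alphabet M B" by (auto simp: alphabet_def)
  with Conn show ?case by (fastforce simp: in_lists_conv_set)
qed (auto simp: alphabet_def)

section \<open>The machine\<close>

text \<open>\<open>Scan\<close> runs to the end of the input, \<open>Push\<close> writes a computed
  value, and \<open>Finish\<close> checks that no value is left. Countability supplies the coding by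
  natural numbers that a machine requires.\<close>

datatype control =
    Scan
  | Collect bool "(bool \<times> bool) list"
  | Push "bool \<times> bool"
  | Finish
  | Accept
  | Reject

instance control :: countable
  by countable_datatype

text \<open>In state \<open>Collect p vs\<close> the arguments \<open>vs\<close> of the current letter have already been
  popped. The stack occupies consecutive cells of the second tape, with the head on its top and a
  blank below its bottom; cells above the head may contain leftovers of popped values.\<close>

definition value_symbol :: "bool \<times> bool \<Rightarrow> letter tape_symbol" where
  "value_symbol v = Inr (Suc (to_nat v))"

fun symbol_value :: "letter tape_symbol \<Rightarrow> (bool \<times> bool) option" where
  "symbol_value (Inr (Suc n)) = Some (from_nat n)"
| "symbol_value _ = None"

lemma symbol_value_simps [simp]: "symbol_value (value_symbol v) = Some v" "symbol_value blank = None"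
  by (simp_all add: value_symbol_def)

text \<open>A step writes before it moves, so pushing takes two steps: the head first goes to the
  cell above the top, then \<open>Push\<close> writes there.\<close>

fun control_step :: "control \<Rightarrow> letter tape_symbol \<Rightarrow> letter tape_symbol \<Rightarrow>
    control \<times> letter tape_symbol \<times> move \<times> move" where
  "control_step Scan g h =
     (case g of Inl a \<Rightarrow> (Scan, h, MoveRight, Stay) | Inr _ \<Rightarrow> (Collect False [], h, MoveLeft, Stay))"
| "control_step (Collect p vs) g h =
     (case g of
        Inl a \<Rightarrow>
          if is_bit a then (Collect True vs, h, MoveLeft, Stay)
          else if p \<and> a \<noteq> LVar then (Reject, h, Stay, Stay)
          else if arity a \<le> length vs then (Push (apply_letter a vs), h, MoveLeft, MoveRight)
          else (case symbol_value h of
              None \<Rightarrow> (Reject, h, Stay, Stay)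
            | Some v \<Rightarrow> (Collect p (vs @ [v]), h, Stay, MoveLeft))
      | Inr _ \<Rightarrow>
          (case symbol_value h of
              None \<Rightarrow> (Reject, h, Stay, Stay)
            | Some v \<Rightarrow> (if \<not> p \<and> (fst v \<or> snd v) then Finish else Reject, h, Stay, MoveLeft)))"
| "control_step (Push v) g h = (Collect False [], value_symbol v, Stay, Stay)"
| "control_step Finish g h = (if h = blank then Accept else Reject, h, Stay, Stay)"
| "control_step Accept g h = (Accept, h, Stay, Stay)"
| "control_step Reject g h = (Reject, h, Stay, Stay)"

definition controls :: "nat \<Rightarrow> control set" where
  "controls K = {Scan, Finish, Accept, Reject} \<union> range Push \<union>
     (\<lambda>(p, vs). Collect p vs) ` (UNIV \<times> {vs. length vs \<le> K})"

text \<open>The input tape is read-only: the scanned symbol \<open>gs ! 0\<close> is always written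
  back.\<close>

definition sat_machine :: "letter set \<Rightarrow> nat \<Rightarrow> letter turing_machine" where
  "sat_machine \<Sigma> K =
     \<lparr>tape_count = 2,
      control_states = to_nat ` controls K,
      tape_alphabet = Inl ` \<Sigma> \<union> {blank} \<union> range value_symbol,
      start_state = to_nat Scan,
      accept_state = to_nat Accept,
      reject_state = to_nat Reject,
      transition = \<lambda>q gs. case control_step (from_nat q) (gs ! 0) (gs ! 1) of
        (q', h, m, m') \<Rightarrow> (to_nat q', [gs ! 0, h], [m, m'])\<rparr>"

section \<open>Well-formedness of the machine\<close>

lemma finite_controls: "finite (controls K)"
proof -
  have "finite {vs :: (bool \<times> bool) list. length vs \<le> K}"
    using finite_lists_length_le[of "UNIV :: (bool \<times> bool) set" K] by simp
  then show ?thesis by (simp add: controls_def)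
qed

text \<open>A value is collected only while the list is shorter than the arity of the scanned
  letter, so its length never exceeds \<open>K\<close>.\<close>

lemma control_step_closed:
  assumes "q \<in> controls K" "\<And>a. g = Inl a \<Longrightarrow> arity a \<le> K" "control_step q g h = (q', h', m)"
  shows "q' \<in> controls K" "h' = h \<or> h' \<in> range value_symbol"
  using assms
  by (cases q; force simp: controls_def split: sum.splits if_splits option.splits)+

lemma is_turing_machine_sat_machine:
  assumes "finite \<Sigma>" "\<And>a. a \<in> \<Sigma> \<Longrightarrow> arity a \<le> K"
  shows "is_turing_machine \<Sigma> (sat_machine \<Sigma> K)"
proof -
  let ?A = "Inl ` \<Sigma> \<union> {blank} \<union> range value_symbol"
  have "case transition (sat_machine \<Sigma> K) (to_nat q) gs of (q', hs, ms) \<Rightarrow>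
      q' \<in> to_nat ` controls K \<and> hs \<in> lists ?A \<and> length hs = 2 \<and> length ms = 2"
    if q: "q \<in> controls K" and gs: "gs \<in> lists ?A" "length gs = 2" for q gs
  proof -
    obtain g h where gh: "gs = [g, h]" using gs(2) by (auto simp: numeral_2_eq_2 length_Suc_conv)
    obtain q' h' m m' where st: "control_step q g h = (q', h', m, m')" by (metis prod_cases4)
    have g: "arity a \<le> K" if "g = Inl a" for a
      using that gs(1) assms(2) by (auto simp: gh value_symbol_def)
    have "q' \<in> controls K" "h' \<in> ?A"
      using control_step_closed[OF q g st] gs(1) by (auto simp: gh)
    then show ?thesis using gs(1) by (simp add: sat_machine_def gh st)
  qed
  then have closed: "\<forall>q \<in> to_nat ` controls K - {to_nat Accept, to_nat Reject}.
      \<forall>gs \<in> lists ?A. length gs = 2 \<longrightarrow>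
        (case transition (sat_machine \<Sigma> K) q gs of (q', hs, ms) \<Rightarrow>
          q' \<in> to_nat ` controls K \<and> hs \<in> lists ?A \<and> length hs = 2 \<and> length ms = 2)"
    by (intro ballI impI) (elim DiffE imageE, simp only:)
  have fields: "tape_count (sat_machine \<Sigma> K) = 2"
      "control_states (sat_machine \<Sigma> K) = to_nat ` controls K"
      "tape_alphabet (sat_machine \<Sigma> K) = ?A"
      "start_state (sat_machine \<Sigma> K) = to_nat Scan"
      "accept_state (sat_machine \<Sigma> K) = to_nat Accept"
      "reject_state (sat_machine \<Sigma> K) = to_nat Reject"
    by (simp_all add: sat_machine_def)
  have "Scan \<in> controls K" "Accept \<in> controls K" "Reject \<in> controls K"
    by (auto simp: controls_def)
  then show ?thesis
    unfolding is_turing_machine_def fields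
    by (intro conjI closed) (use assms(1) finite_controls[of K] in auto)
qed

lemma step_sat_machine:
  assumes "q \<noteq> Accept" "q \<noteq> Reject" "control_step q (t p) (t' p') = (q', h, m, m')"
  shows "step (sat_machine \<Sigma> K) (to_nat q, [(t, p), (t', p')]) =
    (to_nat q', [(t, move_head m p), (t'(p' := h), move_head m' p')])"
  using assms by (simp add: sat_machine_def)

section \<open>Verdicts within a step budget\<close>

definition halts_within :: "'a turing_machine \<Rightarrow> nat \<Rightarrow> 'a configuration \<Rightarrow> bool \<Rightarrow> bool" where
  "halts_within M n C b \<longleftrightarrow>
     (\<exists>t\<le>n. fst ((step M ^^ t) C) = (if b then accept_state M else reject_state M))"

lemma halts_within_step: "halts_within M n (step M C) b \<Longrightarrow> halts_within M (Suc n) C b"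
  unfolding halts_within_def by (metis Suc_le_mono comp_apply funpow_Suc_right)

lemma halts_within_mono: "halts_within M m C b \<Longrightarrow> m \<le> n \<Longrightarrow> halts_within M n C b"
  unfolding halts_within_def by (meson order_trans)

lemma halts_within_sat_machine:
  "halts_within (sat_machine \<Sigma> K) n (to_nat Accept, ts) True"
  "halts_within (sat_machine \<Sigma> K) n (to_nat Reject, ts) False"
  by (auto simp: halts_within_def sat_machine_def intro!: exI[of _ 0])

text \<open>Symbolic execution backwards: a verdict after one transition is carried to the
  configuration before it, at the cost of one step.\<close>

lemma halts_within_control_step:
  assumes "control_step q (t p) (t' p') = (q', h, m, m')" "q \<noteq> Accept" "q \<noteq> Reject"
    and "halts_within (sat_machine \<Sigma> K) n
      (to_nat q', [(t, move_head m p), (t'(p' := h), move_head m' p')]) b"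
  shows "halts_within (sat_machine \<Sigma> K) (Suc n) (to_nat q, [(t, p), (t', p')]) b"
proof (rule halts_within_step)
  show "halts_within (sat_machine \<Sigma> K) n
      (step (sat_machine \<Sigma> K) (to_nat q, [(t, p), (t', p')])) b"
    using assms(4) by (subst step_sat_machine[of q t p t' p' q' h m m']) (use assms(1-3) in auto)
qed

section \<open>The stack and the processing of one letter\<close>

fun stack_at :: "(int \<Rightarrow> letter tape_symbol) \<Rightarrow> int \<Rightarrow> (bool \<times> bool) list \<Rightarrow> bool" where
  "stack_at t p [] \<longleftrightarrow> t p = blank"
| "stack_at t p (v # st) \<longleftrightarrow> t p = value_symbol v \<and> stack_at t (p - 1) st"

lemma stack_at_update_above: "p < q \<Longrightarrow> stack_at (t(q := h)) p st = stack_at t p st"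
  by (induction st arbitrary: p) auto

text \<open>The stack runs out too early: after \<open>length st\<close> pops the head meets the
  blank below the bottom, and one more step rejects.\<close>

lemma halts_within_collect_reject:
  assumes "t p = Inl a" "\<not> is_bit a" "pend \<longrightarrow> a = LVar" "stack_at t' p' st"
    and "length vs + length st < arity a"
  shows "halts_within (sat_machine \<Sigma> K) (Suc (length st))
    (to_nat (Collect pend vs), [(t, p), (t', p')]) False"
  using assms(4,5)
proof (induction st arbitrary: vs p')
  case Nil
  then show ?case
    by (intro halts_within_control_step[where q' = Reject and h = blank and m = Stay and m' = Stay])
      (use assms(1-3) in \<open>auto intro: halts_within_sat_machine\<close>)
next
  case (Cons v st)
  have "halts_within (sat_machine \<Sigma> K) (Suc (length st))
      (to_nat (Collect pend (vs @ [v])), [(t, p), (t', p' - 1)]) False"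
    using Cons.prems by (intro Cons.IH) auto
  then show ?case
    by (intro halts_within_control_step[where q' = "Collect pend (vs @ [v])" and h = "t' p'"
          and m = Stay and m' = MoveLeft])
      (use assms(1-3) Cons.prems in \<open>auto simp: fun_upd_idem\<close>)
qed

text \<open>\<open>k\<close> counts the arguments still to be popped. The budget consists of
  \<open>k\<close> pops, two steps for the push, and \<open>n\<close> for the continuation, which is
  assumed for every tape carrying the new stack because leftovers and head position vary.\<close>

lemma halts_within_collect_apply:
  assumes "t p = Inl a" "\<not> is_bit a" "pend \<longrightarrow> a = LVar" "stack_at t' p' st"
    and "length vs + k = arity a" "k \<le> length st"
    and "\<And>t' p'. stack_at t' p' (apply_letter a (vs @ take k st) # drop k st) \<Longrightarrow>
      halts_within (sat_machine \<Sigma> K) n (to_nat (Collect False []), [(t, p - 1), (t', p')]) b"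
  shows "halts_within (sat_machine \<Sigma> K) (n + k + 2)
    (to_nat (Collect pend vs), [(t, p), (t', p')]) b"
  using assms(4-)
proof (induction k arbitrary: vs p' st)
  case 0
  let ?v = "apply_letter a vs"
  \<comment> \<open>The result overwrites whatever was left in the cell just above the remaining
    stack.\<close>
  have "stack_at (t'(p' + 1 := value_symbol ?v)) (p' + 1) (?v # st)"
    using 0 by (simp add: stack_at_update_above)
  then have "halts_within (sat_machine \<Sigma> K) n
      (to_nat (Collect False []), [(t, p - 1), (t'(p' + 1 := value_symbol ?v), p' + 1)]) b"
    using 0(4) by simp
  then have push: "halts_within (sat_machine \<Sigma> K) (Suc n)
      (to_nat (Push ?v), [(t, p - 1), (t', p' + 1)]) b"
    by (intro halts_within_control_step[where q' = "Collect False []" and h = "value_symbol ?v"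
          and m = Stay and m' = Stay]) auto
  have "halts_within (sat_machine \<Sigma> K) (Suc (Suc n))
      (to_nat (Collect pend vs), [(t, p), (t', p')]) b"
    by (rule halts_within_control_step[where q' = "Push ?v" and h = "t' p'"
          and m = MoveLeft and m' = MoveRight]) (use assms(1-3) 0 push in auto)
  then show ?case by simp
next
  case (Suc k)
  then obtain v st' where st: "st = v # st'" by (cases st) auto
  have "halts_within (sat_machine \<Sigma> K) (n + k + 2)
      (to_nat (Collect pend (vs @ [v])), [(t, p), (t', p' - 1)]) b"
    using Suc.prems st by (intro Suc.IH) auto
  then have "halts_within (sat_machine \<Sigma> K) (Suc (n + k + 2))
      (to_nat (Collect pend vs), [(t, p), (t', p')]) b"
    by (intro halts_within_control_step[where q' = "Collect pend (vs @ [v])" and h = "t' p'"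
          and m = Stay and m' = MoveLeft])
      (use assms(1-3) Suc.prems st in \<open>auto simp: fun_upd_idem\<close>)
  then show ?case by simp
qed

text \<open>The first step pops and tests the top value; the second tests whether the cell below is
  blank, that is, whether this was the only value.\<close>

lemma halts_within_end_of_input:
  assumes "t p = blank" "stack_at t' p' st"
  shows "halts_within (sat_machine \<Sigma> K) 2 (to_nat (Collect pend []), [(t, p), (t', p')])
    (\<not> pend \<and> (\<exists>v. st = [v] \<and> (fst v \<or> snd v)))"
proof (cases st)
  case Nil
  then have "halts_within (sat_machine \<Sigma> K) (Suc 1)
      (to_nat (Collect pend []), [(t, p), (t', p')]) False"
    by (intro halts_within_control_step[where q' = Reject and h = blank and m = Stay and m' = Stay])
      (use assms in \<open>auto intro: halts_within_sat_machine\<close>)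
  with Nil show ?thesis by (simp add: numeral_2_eq_2)
next
  case (Cons v st')
  let ?good = "\<not> pend \<and> (fst v \<or> snd v)"
  have top: "t' p' = value_symbol v" "stack_at t' (p' - 1) st'" using assms(2) Cons by auto
  have "halts_within (sat_machine \<Sigma> K) (Suc 1) (to_nat (Collect pend []), [(t, p), (t', p')])
      (?good \<and> st' = [])"
  proof (rule halts_within_control_step[where q' = "if ?good then Finish else Reject"
          and h = "t' p'" and m = Stay and m' = MoveLeft])
    have "t' (p' - 1) = blank \<longleftrightarrow> st' = []"
      using top(2) by (cases st') (auto simp: value_symbol_def)
    then have "halts_within (sat_machine \<Sigma> K) (Suc 0) (to_nat Finish, [(t, p), (t', p' - 1)]) (st' = [])"
      by (intro halts_within_control_step[where q' = "if st' = [] then Accept else Reject"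
            and h = "t' (p' - 1)" and m = Stay and m' = Stay])
        (auto intro: halts_within_sat_machine)
    then show "halts_within (sat_machine \<Sigma> K) 1 (to_nat (if ?good then Finish else Reject),
        [(t, move_head Stay p), (t'(p' := t' p'), move_head MoveLeft p')]) (?good \<and> st' = [])"
      by (auto intro: halts_within_sat_machine)
  qed (use assms(1) top in auto)
  moreover have "(\<not> pend \<and> (\<exists>v. st = [v] \<and> (fst v \<or> snd v))) = (?good \<and> st' = [])"
    using Cons by auto
  ultimately show ?thesis by (simp only: numeral_2_eq_2 One_nat_def)
qed

section \<open>Complete runs and the time bound\<close>

text \<open>Failure is permanent, so the machine may reject without reading the rest of the
  input.\<close>

lemma eval_word_append_None: "eval_word v = None \<Longrightarrow> eval_word (u @ v) = None"
  by (induction u) auto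

text \<open>Invariant of the backward pass: \<open>u\<close> is unread, and the stack holds the
  evaluation of the suffix \<open>v\<close>. A letter costs at most \<open>K\<close> pops and two
  steps for the push, and the end of the input costs two steps.\<close>

lemma halts_within_eval_word:
  assumes "\<And>a. a \<in> set u \<Longrightarrow> arity a \<le> K"
    and "eval_word v = Some (pend, st)" "stack_at t' p' st"
  shows "halts_within (sat_machine \<Sigma> K) (length u * (K + 2) + 2)
    (to_nat (Collect pend []), [(fst (input_tape (u @ v)), int (length u) - 1), (t', p')])
    (accepts_word (u @ v))"
  using assms
proof (induction u arbitrary: v pend st t' p' rule: rev_induct)
  case Nil
  have "accepts_word v \<longleftrightarrow> \<not> pend \<and> (\<exists>v. st = [v] \<and> (fst v \<or> snd v))"
    using Nil.prems(2) by (auto simp: accepts_word_def)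
  \<comment> \<open>With nothing left to read, the head stands on the blank just left of the
    input.\<close>
  moreover have "fst (input_tape v) (- 1) = blank" by (simp add: input_tape_def)
  ultimately show ?case
    using halts_within_end_of_input[OF _ Nil.prems(3), of "fst (input_tape v)" "- 1" \<Sigma> K pend]
    by (simp add: numeral_2_eq_2)
next
  case (snoc a u)
  let ?t = "fst (input_tape (u @ a # v))"
  have head: "?t (int (length u)) = Inl a" by (simp add: input_tape_def nth_append)
  have arity: "arity a \<le> K" and rest: "\<And>a. a \<in> set u \<Longrightarrow> arity a \<le> K"
    using snoc.prems(1) by auto
  have IH: "halts_within (sat_machine \<Sigma> K) (length u * (K + 2) + 2)
      (to_nat (Collect pend []), [(?t, int (length u) - 1), (t', p')]) (accepts_word (u @ a # v))"
    if "eval_word (a # v) = Some (pend, st)" "stack_at t' p' st" for pend st t' p'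
    using snoc.IH[OF rest that] by simp
  let ?goal = "\<lambda>n. halts_within (sat_machine \<Sigma> K) n
    (to_nat (Collect pend []), [(?t, int (length u)), (t', p')]) (accepts_word (u @ a # v))"
  let ?n = "length u * (K + 2) + 2"
  \<comment> \<open>These are the branches of \<open>eval_word\<close> on \<open>a # v\<close>; the
    second and third are its failures.\<close>
  consider (bit) "is_bit a" | (pend) "\<not> is_bit a" "pend" "a \<noteq> LVar"
    | (short) "\<not> is_bit a" "pend \<longrightarrow> a = LVar" "length st < arity a"
    | (enough) "\<not> is_bit a" "pend \<longrightarrow> a = LVar" "arity a \<le> length st"
    by linarith
  then have "\<exists>n \<le> ?n + K + 2. ?goal n"
  proof cases
    case bit
    then have "eval_word (a # v) = Some (True, st)" using snoc.prems(2) by simp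
    from IH[OF this snoc.prems(3)] have "?goal (Suc ?n)"
      by (intro halts_within_control_step[where q' = "Collect True []" and h = "t' p'"
            and m = MoveLeft and m' = Stay]) (use bit head in auto)
    then show ?thesis by (intro exI[of _ "Suc ?n"]) simp
  next
    case pend
    then have "\<not> accepts_word (u @ a # v)"
      using snoc.prems(2) eval_word_append_None[of "a # v" u] by (simp add: accepts_word_def)
    then have "?goal (Suc 0)"
      by (intro halts_within_control_step[where q' = Reject and h = "t' p'"
            and m = Stay and m' = Stay])
        (use pend head in \<open>auto intro: halts_within_sat_machine\<close>)
    then show ?thesis by (intro exI[of _ "Suc 0"]) simp
  next
    case short
    then have "\<not> accepts_word (u @ a # v)"
      using snoc.prems(2) eval_word_append_None[of "a # v" u] by (simp add: accepts_word_def)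
    then have "?goal (Suc (length st))"
      using halts_within_collect_reject[of ?t "int (length u)" a pend t' p' st "[]"]
        head short snoc.prems(3) by simp
    then show ?thesis using short(3) arity by (intro exI[of _ "Suc (length st)"]) simp
  next
    case enough
    then have "eval_word (a # v) =
        Some (False, apply_letter a (take (arity a) st) # drop (arity a) st)"
      using snoc.prems(2) by auto
    note IH' = IH[OF this]
    have "?goal (?n + arity a + 2)"
      by (rule halts_within_collect_apply[where a = a and st = st])
        (use IH' head enough snoc.prems(3) in simp_all)
    then show ?thesis using arity by (intro exI[of _ "?n + arity a + 2"]) simp
  qed
  then show ?case by (auto elim!: halts_within_mono)
qed

text \<open>\<open>k\<close> is the distance from the head to the blank behind the input, where the
  induction starts. Scanning costs \<open>k\<close> steps and one more to turn round.\<close>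

lemma halts_within_scan:
  assumes "\<And>a. a \<in> set w \<Longrightarrow> arity a \<le> K" "k \<le> length w"
  shows "halts_within (sat_machine \<Sigma> K) (Suc k + (length w * (K + 2) + 2))
    (to_nat Scan, [(fst (input_tape w), int (length w) - int k), blank_tape]) (accepts_word w)"
  using assms(2)
proof (induction k)
  case 0
  have "halts_within (sat_machine \<Sigma> K) (length w * (K + 2) + 2)
      (to_nat (Collect False []), [(fst (input_tape w), int (length w) - 1), blank_tape])
      (accepts_word w)"
    using halts_within_eval_word[OF assms(1), of w "[]" False "[]"]
    by (simp add: blank_tape_def)
  then have "halts_within (sat_machine \<Sigma> K) (Suc (length w * (K + 2) + 2))
      (to_nat Scan, [(fst (input_tape w), int (length w)), (\<lambda>_. blank, 0)]) (accepts_word w)"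
    by (intro halts_within_control_step[where q' = "Collect False []" and h = blank
            and m = MoveLeft and m' = Stay])
      (auto simp: input_tape_def blank_tape_def fun_upd_idem)
  then show ?case by (simp add: blank_tape_def)
next
  case (Suc k)
  let ?p = "int (length w) - int (Suc k)"
  have "\<exists>a. fst (input_tape w) ?p = Inl a" using Suc.prems by (simp add: input_tape_def)
  then have "halts_within (sat_machine \<Sigma> K) (Suc (Suc k + (length w * (K + 2) + 2)))
      (to_nat Scan, [(fst (input_tape w), ?p), (\<lambda>_. blank, 0)]) (accepts_word w)"
    using Suc by (intro halts_within_control_step[where q' = Scan and h = blank
            and m = MoveRight and m' = Stay]) (auto simp: blank_tape_def fun_upd_idem)
  then show ?case by (simp add: blank_tape_def)
qed

lemma decides_in_time_sat_machine:
  assumes "\<And>a. a \<in> \<Sigma> \<Longrightarrow> arity a \<le> K" "\<And>w. w \<in> lists \<Sigma> \<Longrightarrow> w \<in> L \<longleftrightarrow> accepts_word w"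
  shows "decides_in_time (sat_machine \<Sigma> K) \<Sigma> L (poly [:3, K + 3:])"
  unfolding decides_in_time_def
proof
  fix w assume w: "w \<in> lists \<Sigma>"
  have "halts_within (sat_machine \<Sigma> K) (poly [:3, K + 3:] (length w))
      (initial_configuration (sat_machine \<Sigma> K) w) (w \<in> L)"
  proof -
    have "initial_configuration (sat_machine \<Sigma> K) w =
        (to_nat Scan, [(fst (input_tape w), int (length w) - int (length w)), blank_tape])"
      by (simp add: initial_configuration_def sat_machine_def input_tape_def)
    \<comment> \<open>The summands are the scan to the right, the evaluation letter by letter, and
      the final test.\<close>
    moreover have "poly [:3, K + 3:] (length w) = Suc (length w) + (length w * (K + 2) + 2)"
      by (simp add: algebra_simps)
    moreover have "arity a \<le> K" if "a \<in> set w" for a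
      using that w assms(1) by auto
    ultimately show ?thesis
      using halts_within_scan[of w K "length w" \<Sigma>] assms(2)[OF w]
      by (simp only: order_refl)
  qed
  then show "\<exists>t\<le>poly [:3, K + 3:] (length w).
      fst ((step (sat_machine \<Sigma> K) ^^ t) (initial_configuration (sat_machine \<Sigma> K) w)) =
        (if w \<in> L then accept_state (sat_machine \<Sigma> K) else reject_state (sat_machine \<Sigma> K))"
    by (simp add: halts_within_def)
qed

theorem theorem3p6:
  fixes B :: "boolfun set"
  assumes "finite B" and "B \<subseteq> clone_N"
  shows "polynomial_time_decidable (alphabet {OpF, OpG, OpX, OpU, OpS} B)
           (SAT {OpF, OpG, OpX, OpU, OpS} B)"
proof -
  let ?\<Sigma> = "alphabet {OpF, OpG, OpX, OpU, OpS} B"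
  \<comment> \<open>\<open>K\<close> depends on \<open>B\<close> alone, so it may enter the
    coefficients of the time bound.\<close>
  define K where "K = Max (arity ` ?\<Sigma>)"
  have fin: "finite ?\<Sigma>" using assms(1) by (simp add: alphabet_def)
  have K: "arity a \<le> K" if "a \<in> ?\<Sigma>" for a using that fin by (simp add: K_def)
  have "SAT {OpF, OpG, OpX, OpU, OpS} B \<subseteq> lists ?\<Sigma>"
    unfolding SAT_def using encode_in_lists_alphabet by blast
  moreover have "is_turing_machine ?\<Sigma> (sat_machine ?\<Sigma> K)"
    using fin K by (rule is_turing_machine_sat_machine)
  moreover have "decides_in_time (sat_machine ?\<Sigma> K) ?\<Sigma> (SAT {OpF, OpG, OpX, OpU, OpS} B)
      (poly [:3, K + 3:])"
    using K SAT_iff_accepts_word[OF assms(2)] by (rule decides_in_time_sat_machine)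
  ultimately show ?thesis using fin unfolding polynomial_time_decidable_def by blast
qed

end
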